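(* Let $p>1$, $q\geq 1$, $r\in\mathbb{N}$ and $c>0$. Let $(b_n)_{n\ge 1}$ be a sequence of complex numbers belonging to the class $GM(p,{}_3\beta(q),r)$. Suppose that $$n\ln n\,|b_n|\to 0\quad\text{as } n\to\infty,$$ and, in case $r\geq 3$, that the series $$\sum_{k=1}^{\infty} b_k\sin\left(\frac{2l\pi}{r}k\right)$$ converges for all $l=1,\dots,[\frac r2]-1$ when $r$ is even, and for all $l=1,\dots,[\frac r2]$ when $r$ is odd. Then the series $$\sum_{n=1}^{\infty} b_n\sin(cnx)$$ is uniformly convergent (with respect to $x\in\mathbb{R}$).
   Context: $\mathbb{N}=\{1,2,3,\dots\}$ and $[x]$ denotes the integer part of $x$. For a sequence $(a_n)$ and $r\in\mathbb{N}$ put $\Delta_r a_n=a_n-a_{n+r}$. Definition of the class $GM(p,{}_3\beta(q),r)$, for real $p,q>0$ and $r\in\mathbb{N}$: a sequence $a=(a_n)_{n\ge1}$ of complex numbers with $a_n\to0$ belongs to $GM(p,{}_3\beta(q),r)$ if there exist a constant $C$ (depending only on $a$) and a nonnegative, monotonically nondecreasing sequence $(b(n))_{n\ge1}$ of real numbers with $b(n)\to\infty$ (depending only on $a$; not to be confused with a coefficient sequence $(b_n)$), such that for all $n\in\mathbb{N}$ $$\left(\sum_{k=n}^{2n-1}|\Delta_r a_k|^p\right)^{1/p}\leq C\cdot {}_3\beta_n(q),\qquad {}_3\beta_n(q)=\frac1n\sup_{m\geq b(n)} m\left(\frac1m\sum_{k=m}^{2m}|a_k|^q\right)^{1/q},$$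 where the supremum is over $m\in\mathbb{N}$ with $m\ge b(n)$. *)

theory Defs
  imports "HOL-Analysis.Analysis"
begin

text \<open>
  Sequences indexed by the positive integers are functions on \<open>nat\<close> of which only the values at
  arguments \<open>\<ge> 1\<close> are used.
\<close>

definition Delta :: "nat \<Rightarrow> (nat \<Rightarrow> complex) \<Rightarrow> nat \<Rightarrow> complex" where
  "Delta r a n = a n - a (n + r)"

text \<open>
  The supremum need not be finite for a general null sequence, so it is taken in the extended
  reals; the inequality defining the class below is then vacuous when the right-hand side is
  infinite and the constant positive.
\<close>

definition beta3 :: "real \<Rightarrow> (nat \<Rightarrow> real) \<Rightarrow> (nat \<Rightarrow> complex) \<Rightarrow> nat \<Rightarrow> ereal" where
  "beta3 q b a n =
     ereal (1 / real n) *
     (SUP m \<in> {m::nat. m \<ge> 1 \<and> real m \<ge> b n}.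
        ereal (real m * (1 / real m * (\<Sum>k=m..2*m. cmod (a k) powr q)) powr (1 / q)))"

definition GM :: "real \<Rightarrow> real \<Rightarrow> nat \<Rightarrow> (nat \<Rightarrow> complex) set" where
  "GM p q r = {a. a \<longlonglongrightarrow> 0 \<and>
     (\<exists>(C::real) (b::nat \<Rightarrow> real).
        (\<forall>n\<ge>1. 0 \<le> b n) \<and> mono_on {1..} b \<and> filterlim b at_top sequentially \<and>
        (\<forall>n\<ge>1. ereal ((\<Sum>k=n..2*n-1. cmod (Delta r a k) powr p) powr (1 / p))
                  \<le> ereal C * beta3 q b a n))}"

end

theory Submission
  imports Defs
begin

text \<open>
  The difficulty is to bound a block \<open>\<Sum>k=m..<n. b k * sin (k x)\<close> uniformly in \<open>x\<close> when \<open>m\<close> is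
  large. The multiples of \<open>2 \<pi> / r\<close>, called nodes here, are the points where \<open>exp (i r x) = 1\<close>,
  that is, where summation by parts with step \<open>r\<close> gives nothing. Write \<open>x = y + t\<close> with \<open>y\<close> the
  node nearest to \<open>x\<close>, and cut the block at \<open>1/\<bar>t\<bar>\<close> and at \<open>(1/\<bar>t\<bar>) powr p\<close>.

  \<^item> For \<open>k \<le> 1/\<bar>t\<bar>\<close> the series at \<open>x\<close> is compared with the series at \<open>y\<close>: replacing
    \<open>sin (k x)\<close> by \<open>sin (k y)\<close> costs at most \<open>k \<bar>t\<bar> \<bar>b k\<bar>\<close>, which adds up to little
    since \<open>k \<bar>b k\<bar>\<close> is small (\<open>norm_sine_block_near_node_le\<close>). Up to sign and period there are
    only finitely many nodes; at each of them the sine series converges, by hypothesis or because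
    all its terms vanish.

  \<^item> For \<open>1/\<bar>t\<bar> < k \<le> (1/\<bar>t\<bar>) powr p\<close> absolute values suffice: the sum of \<open>1 / (k ln k)\<close> over
    \<open>M < k \<le> M powr p\<close> stays bounded as \<open>M\<close> grows, because \<open>ln ln\<close> increases by only \<open>ln p\<close> there
    (\<open>norm_sine_block_log_range_le\<close>). This is where the factor \<open>ln n\<close> in the hypothesis
    is spent.

  \<^item> For \<open>k > (1/\<bar>t\<bar>) powr p\<close> summation by parts with step \<open>r\<close> costs a factor of order \<open>1/\<bar>t\<bar>\<close>,
    and the class condition pays for it (\<open>norm_sine_block_far_le\<close>). Since \<open>k \<bar>b k\<bar> \<longlonglongrightarrow> 0\<close>, the
    quantity \<open>beta3\<close> bounding the \<open>p\<close>-norm of the differences over \<open>{n..<2 n}\<close> is \<open>o(1/n)\<close>, but with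
    no rate, because the threshold in the supremum may tend to infinity arbitrarily slowly.
    Passing from the \<open>p\<close>-norm to the \<open>1\<close>-norm and adding dyadic blocks gives only
    \<open>\<Sum>k\<ge>m. \<bar>\<Delta>\<^sub>r b k\<bar> = o(m powr (-1/p))\<close> (\<open>GM_imp_sum_Delta_le\<close>), which is small compared with
    \<open>\<bar>t\<bar>\<close> for \<open>m\<close> beyond the second cut.

  The bound for the block is then a constant depending on \<open>p\<close> and \<open>r\<close> times the small quantity
  (\<open>norm_sine_block_le\<close>), and uniform convergence is Cauchy's criterion; the factor
  \<open>c\<close> is absorbed into \<open>x\<close>.
\<close>

section \<open>Sums of the reciprocals of k ln k\<close>

lemma mult_le_mult_ln_mult:
  assumes "n \<ge> 3" "u \<ge> 0"
  shows "real n * u \<le> real n * ln (real n) * u"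
proof -
  have "exp 1 \<le> (3::real)" by (rule exp_le)
  hence "1 \<le> ln (real n)" using assms by (subst ln_ge_iff) auto
  hence "1 * (real n * u) \<le> ln (real n) * (real n * u)"
    using assms by (intro mult_right_mono) auto
  thus ?thesis by (simp add: mult_ac)
qed

text \<open>A discrete form of \<open>(ln ln)' u = 1 / (u ln u)\<close>: the tangent inequality for \<open>ln\<close> is used twice.\<close>

lemma inverse_mult_ln_le_ln_ln_diff:
  fixes k :: nat
  assumes "k \<ge> 2"
  shows "1 / (real (Suc k) * ln (real (Suc k))) \<le> ln (ln (real (Suc k))) - ln (ln (real k))"
proof -
  let ?L = "ln (real k)" and ?L' = "ln (real (Suc k))"
  have pos: "?L > 0" "?L' > 0" using assms by auto
  have "ln (real k) - ln (real (Suc k)) \<le> (real k - real (Suc k)) / real (Suc k)"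
    using assms by (intro ln_diff_le) auto
  hence "1 / real (Suc k) \<le> ?L' - ?L" by (simp add: field_simps)
  hence "1 / real (Suc k) / ?L' \<le> (?L' - ?L) / ?L'" using pos by (intro divide_right_mono) auto
  also have "\<dots> \<le> ln ?L' - ln ?L"
    using ln_diff_le[of ?L ?L'] pos by (simp add: field_simps)
  finally show ?thesis by simp
qed

text \<open>
  The sum telescopes to \<open>ln ln (n - 1) - ln ln (m - 1)\<close>. Here \<open>ln (n - 1) \<le> p ln m\<close>, and
  \<open>ln m \<le> 2 ln (m - 1)\<close> absorbs the shift of the lower end into the factor 2.
\<close>

lemma sum_inverse_mult_ln_le:
  fixes m n :: nat and p :: real
  assumes "3 \<le> m" "m < n" "real (n - 1) \<le> real m powr p"
  shows "(\<Sum>k=m..<n. 1 / (real k * ln (real k))) \<le> ln (2 * p)"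
proof -
  define m' n' where "m' = m - 1" and "n' = n - 1"
  have mn: "m = Suc m'" "n = Suc n'" "2 \<le> m'" "m' < n'"
    using assms by (auto simp: m'_def n'_def)
  have "(\<Sum>k=m..<n. 1 / (real k * ln (real k)))
      = (\<Sum>k=m'..<n'. 1 / (real (Suc k) * ln (real (Suc k))))"
    unfolding mn by (rule sum.shift_bounds_Suc_ivl)
  also have "\<dots> \<le> (\<Sum>k=m'..<n'. ln (ln (real (Suc k))) - ln (ln (real k)))"
    using mn by (intro sum_mono inverse_mult_ln_le_ln_ln_diff) auto
  also have "\<dots> = ln (ln (real n')) - ln (ln (real m'))"
    using mn by (intro sum_Suc_diff') auto
  also have "\<dots> = ln (ln (real n') / ln (real m'))"
    using mn by (simp add: ln_div)
  also have "\<dots> \<le> ln (2 * p)"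
  proof -
    have "real m \<le> real m' ^ 2"
    proof -
      have "2 * m' \<le> m' * m'" using mn by simp
      moreover have "m \<le> 2 * m'" using mn by simp
      ultimately have "m \<le> m' ^ 2" unfolding power2_eq_square by (rule order_trans [rotated])
      thus ?thesis by (metis of_nat_le_iff of_nat_power)
    qed
    hence "ln (real m) \<le> ln (real m' ^ 2)" using mn by (subst ln_le_cancel_iff) auto
    hence le2: "ln (real m) \<le> 2 * ln (real m')" using mn by (simp add: ln_realpow)
    have "ln (real n') \<le> ln (real m powr p)"
      using assms mn by (subst ln_le_cancel_iff) auto
    hence lep: "ln (real n') \<le> p * ln (real m)" using mn by (simp add: ln_powr)
    have posn: "ln (real n') > 0" and posm: "ln (real m) > 0" and posm': "ln (real m') > 0"
      using mn by auto
    have "p > 0" using lep posn posm by (meson less_le_trans zero_less_mult_pos2)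
    hence "p * ln (real m) \<le> p * (2 * ln (real m'))" using le2 by (intro mult_left_mono) auto
    hence "ln (real n') / ln (real m') \<le> 2 * p" using lep posm' by (simp add: field_simps)
    thus ?thesis using posn posm' \<open>p > 0\<close> by (subst ln_le_cancel_iff) auto
  qed
  finally show ?thesis .
qed

section \<open>From dyadic p-norms of the differences to tails\<close>

text \<open>
  Hoelder's inequality up to a factor 2, by a threshold \<open>s\<close>: a term is at most \<open>s\<close>, or else at
  most \<open>s powr (1 - p)\<close> times its \<open>p\<close>-th power. The choice \<open>s = A * card I powr (-1/p)\<close> balances
  the two contributions.
\<close>

lemma sum_le_of_powr_sum_le:
  fixes d :: "'a \<Rightarrow> real" and p A :: real
  assumes "finite I" "I \<noteq> {}" "p > 1" "A > 0" "\<And>k. k \<in> I \<Longrightarrow> d k \<ge> 0"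
    and le: "(\<Sum>k\<in>I. d k powr p) powr (1 / p) \<le> A"
  shows "(\<Sum>k\<in>I. d k) \<le> 2 * A * real (card I) powr (1 - 1 / p)"
proof -
  define N where "N = real (card I)"
  have N: "N > 0" using assms by (simp add: N_def card_gt_0_iff)
  define s where "s = A * N powr (- 1 / p)"
  have s: "s > 0" using N assms by (simp add: s_def)
  have summand: "d k \<le> s + d k powr p * s powr (1 - p)" if "k \<in> I" for k
  proof (cases "d k \<le> s")
    case True thus ?thesis by (simp add: add_increasing2)
  next
    case False
    have "d k = d k powr p * d k powr (1 - p)"
      using False s by (simp flip: powr_add)
    also have "\<dots> \<le> d k powr p * s powr (1 - p)"
      using False s assms by (intro mult_left_mono powr_mono2') auto
    finally show ?thesis using s by linarith
  qed
  have sump: "(\<Sum>k\<in>I. d k powr p) \<le> A powr p"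
  proof -
    have "(\<Sum>k\<in>I. d k powr p) = ((\<Sum>k\<in>I. d k powr p) powr (1 / p)) powr p"
      using assms by (simp add: powr_powr sum_nonneg)
    also have "\<dots> \<le> A powr p" using le assms by (intro powr_mono2) auto
    finally show ?thesis .
  qed
  have "(\<Sum>k\<in>I. d k) \<le> (\<Sum>k\<in>I. s + d k powr p * s powr (1 - p))"
    by (intro sum_mono summand)
  also have "\<dots> = N * s + (\<Sum>k\<in>I. d k powr p) * s powr (1 - p)"
    by (simp add: sum.distrib sum_distrib_right N_def)
  also have "\<dots> \<le> N * s + A powr p * s powr (1 - p)"
    using sump by (intro add_left_mono mult_right_mono) auto
  also have "A powr p * s powr (1 - p) = A * N powr (1 - 1 / p)"
  proof -
    have "s powr (1 - p) = A powr (1 - p) * N powr ((- 1 / p) * (1 - p))"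
      using assms N by (simp add: s_def powr_mult powr_powr)
    also have "(- 1 / p) * (1 - p) = 1 - 1 / p" using assms by (simp add: field_simps)
    finally have "A powr p * s powr (1 - p) = (A powr p * A powr (1 - p)) * N powr (1 - 1 / p)"
      by simp
    also have "A powr p * A powr (1 - p) = A" using assms by (simp flip: powr_add)
    finally show ?thesis .
  qed
  also have "N * s = A * N powr (1 - 1 / p)"
    using N by (simp add: s_def powr_diff powr_minus field_simps)
  finally show ?thesis by (simp add: N_def)
qed

text \<open>
  A geometric series of ratio \<open>2 powr - \<alpha>\<close>, summed by induction on the length: with
  \<open>K = A / (1 - 2 powr - \<alpha>)\<close>, peeling off the block \<open>{m..<2 m}\<close> reproduces the bound because
  \<open>A + K * 2 powr - \<alpha> = K\<close>.
\<close>

lemma sum_le_of_dyadic_sums_le: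
  fixes d :: "nat \<Rightarrow> real" and A \<alpha> :: real
  assumes "\<alpha> > 0" "N \<ge> 1" "A \<ge> 0" "\<And>k. d k \<ge> 0"
    and dyadic: "\<And>n. n \<ge> N \<Longrightarrow> (\<Sum>k=n..<2*n. d k) \<le> A * real n powr - \<alpha>"
    and "m \<ge> N"
  shows "(\<Sum>k=m..<n. d k) \<le> A / (1 - 2 powr - \<alpha>) * real m powr - \<alpha>"
  using \<open>m \<ge> N\<close>
proof (induction "n - m" arbitrary: m rule: less_induct)
  case less
  define q where "q = (2::real) powr - \<alpha>"
  define K where "K = A / (1 - q)"
  have q: "q < 1" using assms powr_less_mono[of "-\<alpha>" 0 2] by (simp add: q_def)
  have K: "A + K * q = K" "A \<le> K" "0 \<le> K"
    using q assms mult_nonneg_nonneg[of A q] by (auto simp: K_def field_simps q_def)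
  show ?case
  proof (cases "n \<le> 2 * m")
    case True
    have "(\<Sum>k=m..<n. d k) \<le> (\<Sum>k=m..<2*m. d k)"
      using True assms by (intro sum_mono2) auto
    also have "\<dots> \<le> A * real m powr - \<alpha>" using less.prems by (rule dyadic)
    also have "\<dots> \<le> K * real m powr - \<alpha>" using K by (intro mult_right_mono) auto
    finally show ?thesis by (simp add: K_def q_def)
  next
    case False
    have "(\<Sum>k=m..<n. d k) = (\<Sum>k=m..<2*m. d k) + (\<Sum>k=2*m..<n. d k)"
      using False by (intro sum.atLeastLessThan_concat [symmetric]) auto
    also have "\<dots> \<le> A * real m powr - \<alpha> + K * real (2 * m) powr - \<alpha>"
    proof (intro add_mono dyadic less.prems)
      have "n - 2 * m < n - m" using False less.prems assms by auto
      thus "(\<Sum>k=2*m..<n. d k) \<le> K * real (2 * m) powr - \<alpha>"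
        unfolding K_def q_def using less.prems by (intro less.hyps) auto
    qed
    also have "\<dots> = (A + K * q) * real m powr - \<alpha>"
      by (simp add: powr_mult q_def algebra_simps)
    finally show ?thesis using K by (simp add: K_def q_def)
  qed
qed

text \<open>
  Each of the \<open>m + 1 \<le> 2 m\<close> terms in the mean is at most \<open>(\<eta> / m) powr q\<close>, so the supremum is at
  most \<open>2 powr (1/q) * \<eta>\<close>, and \<open>q \<ge> 1\<close>.
\<close>

lemma beta3_le:
  assumes "q \<ge> 1" "n \<ge> 1" "\<eta> > 0"
    and ak: "\<And>k. real k \<ge> max 1 (b n) \<Longrightarrow> real k * cmod (a k) \<le> \<eta>"
  shows "beta3 q b a n \<le> ereal (2 * \<eta> / real n)"
proof -
  have bound: "real m * (1 / real m * (\<Sum>k=m..2*m. cmod (a k) powr q)) powr (1 / q) \<le> 2 * \<eta>"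
    if m: "m \<ge> 1" "real m \<ge> b n" for m :: nat
  proof -
    have ak': "cmod (a k) powr q \<le> (\<eta> / real m) powr q" if "k \<in> {m..2*m}" for k
    proof -
      have "real m * cmod (a k) \<le> real k * cmod (a k)" using that by (intro mult_right_mono) auto
      also have "\<dots> \<le> \<eta>" using that m by (intro ak) auto
      finally show ?thesis using m assms by (intro powr_mono2) (auto simp: field_simps)
    qed
    have "(\<Sum>k=m..2*m. cmod (a k) powr q) \<le> (\<Sum>k=m..2*m. (\<eta> / real m) powr q)"
      by (intro sum_mono ak')
    also have "\<dots> = real (m + 1) * (\<eta> / real m) powr q" by simp
    also have "\<dots> \<le> (2 powr q * real m) * (\<eta> / real m) powr q"
    proof (intro mult_right_mono)
      have "(2::real) powr 1 \<le> 2 powr q" using assms by (intro powr_mono) auto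
      hence "2 * real m \<le> 2 powr q * real m" by (intro mult_right_mono) auto
      moreover have "real (m + 1) \<le> 2 * real m" using m by simp
      ultimately show "real (m + 1) \<le> 2 powr q * real m" by linarith
    qed auto
    finally have "1 / real m * (\<Sum>k=m..2*m. cmod (a k) powr q) \<le> 2 powr q * (\<eta> / real m) powr q"
      using m by (simp add: field_simps)
    also have "\<dots> = (2 * (\<eta> / real m)) powr q" using assms by (subst powr_mult) auto
    finally have "(1 / real m * (\<Sum>k=m..2*m. cmod (a k) powr q)) powr (1 / q)
        \<le> ((2 * (\<eta> / real m)) powr q) powr (1 / q)"
      using assms by (intro powr_mono2) (auto intro!: divide_nonneg_nonneg sum_nonneg)
    also have "\<dots> = 2 * (\<eta> / real m)" using assms by (simp add: powr_powr)
    finally show ?thesis using m by (simp add: field_simps)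
  qed
  have "beta3 q b a n \<le> ereal (1 / real n) * ereal (2 * \<eta>)"
    unfolding beta3_def using bound
    by (intro ereal_mult_left_mono SUP_least) auto
  thus ?thesis by simp
qed

lemma beta3_nonneg: "beta3 q b a n \<ge> 0"
proof -
  obtain m :: nat where m: "real m \<ge> max 1 (b n)" using real_arch_simple by blast
  let ?g = "\<lambda>m. ereal (real m * (1 / real m * (\<Sum>k=m..2*m. cmod (a k) powr q)) powr (1 / q))"
  have "0 \<le> ?g m" by simp
  also have "\<dots> \<le> (SUP m \<in> {m::nat. m \<ge> 1 \<and> real m \<ge> b n}. ?g m)"
    using m by (intro SUP_upper) auto
  finally show ?thesis unfolding beta3_def by (intro ereal_0_le_mult) auto
qed

text \<open>
  All that the class condition contributes: as soon as the threshold \<open>b n\<close> of the supremum has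
  passed the point from which \<open>k * cmod (a k)\<close> is small, \<open>beta3\<close> is a small multiple of \<open>1 / n\<close>,
  and Hoelder's inequality turns this into \<open>n powr (1 - 1/p) / n\<close> for the sum over \<open>{n..<2 n}\<close>.
\<close>

lemma GM_imp_sum_Delta_le:
  assumes ab: "a \<in> GM p q r" and pq: "p > 1" "q \<ge> 1" 
    and a0: "(\<lambda>n. real n * cmod (a n)) \<longlonglongrightarrow> 0" and "\<eta> > 0"
  obtains N where "\<And>m n. m \<ge> N \<Longrightarrow>
    (\<Sum>k=m..<n. cmod (Delta r a k)) \<le> \<eta> * real m powr - (1 / p)"
proof -
  from ab obtain C b where b: "filterlim b at_top sequentially"
    and C: "\<And>n. n \<ge> 1 \<Longrightarrow> ereal ((\<Sum>k=n..2*n-1. cmod (Delta r a k) powr p) powr (1 / p))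
                  \<le> ereal C * beta3 q b a n"
    unfolding GM_def by blast
  \<comment> \<open>The constant of the class may be negative; since \<open>beta3\<close> is nonnegative it can be enlarged.\<close>
  define C' where "C' = max C 1"
  have C': "C' \<ge> 1" "C' \<ge> C" by (auto simp: C'_def)
  define K where "K = 4 * C' / (1 - 2 powr - (1 / p))"
  have "(2::real) powr - (1 / p) < 2 powr 0" using pq by (intro powr_less_mono) auto
  hence K: "K > 0" using C' by (simp add: K_def)
  define \<zeta> where "\<zeta> = \<eta> / K"
  have \<zeta>: "\<zeta> > 0" using K \<open>\<eta> > 0\<close> by (simp add: \<zeta>_def)
  have "\<forall>\<^sub>F n in sequentially. real n * cmod (a n) < \<zeta>"
    using order_tendstoD(2)[OF a0 \<zeta>] .
  then obtain N1 where N1: "\<And>n. n \<ge> N1 \<Longrightarrow> real n * cmod (a n) < \<zeta>"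
    by (auto simp: eventually_sequentially)
  have "\<forall>\<^sub>F n in sequentially. real N1 \<le> b n"
    using b by (simp add: filterlim_at_top)
  then obtain N2 where N2: "\<And>n. n \<ge> N2 \<Longrightarrow> real N1 \<le> b n"
    by (auto simp: eventually_sequentially)
  define N where "N = max N2 1"
  have dyadic: "(\<Sum>k=n..<2*n. cmod (Delta r a k)) \<le> (4 * C' * \<zeta>) * real n powr - (1 / p)"
    if n: "n \<ge> N" for n
  proof -
    have n1: "n \<ge> 1" "n \<ge> N2" using n by (auto simp: N_def)
    have "ereal ((\<Sum>k=n..2*n-1. cmod (Delta r a k) powr p) powr (1 / p)) \<le> ereal C * beta3 q b a n"
      using n1 by (intro C)
    also have "\<dots> \<le> ereal C' * beta3 q b a n"
      using C' by (intro ereal_mult_right_mono beta3_nonneg) auto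
    also have "\<dots> \<le> ereal C' * ereal (2 * \<zeta> / real n)"
      using C' \<zeta> n1 pq N1 N2
      by (intro ereal_mult_left_mono beta3_le) (auto intro!: less_imp_le, force)
    finally have "(\<Sum>k=n..2*n-1. cmod (Delta r a k) powr p) powr (1 / p) \<le> 2 * C' * \<zeta> / real n"
      by (simp add: field_simps)
    moreover have "{n..2*n-1} = {n..<2*n}" using n1 by auto
    ultimately have "(\<Sum>k=n..<2*n. cmod (Delta r a k))
        \<le> 2 * (2 * C' * \<zeta> / real n) * real (card {n..<2*n}) powr (1 - 1 / p)"
      using n1 pq C' \<zeta> by (intro sum_le_of_powr_sum_le) auto
    also have "\<dots> = (4 * C' * \<zeta>) * real n powr - (1 / p)"
      using n1 by (simp add: powr_diff powr_minus field_simps)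
    finally show ?thesis .
  qed
  show ?thesis
  proof (rule that[of N])
    fix m n assume "m \<ge> N"
    hence "(\<Sum>k=m..<n. cmod (Delta r a k))
        \<le> (4 * C' * \<zeta>) / (1 - 2 powr - (1 / p)) * real m powr - (1 / p)"
      using pq C' \<zeta> dyadic by (intro sum_le_of_dyadic_sums_le[of "1 / p" N]) (auto simp: N_def)
    also have "(4 * C' * \<zeta>) / (1 - 2 powr - (1 / p)) = K * \<zeta>"
      by (simp add: K_def)
    also have "\<dots> = \<eta>"
      using K by (simp add: \<zeta>_def)
    finally show "(\<Sum>k=m..<n. cmod (Delta r a k)) \<le> \<eta> * real m powr - (1 / p)" .
  qed
qed

section \<open>Summation by parts with step r\<close>

lemma sum_shift_diff:
  fixes f :: "nat \<Rightarrow> 'a::ab_group_add"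
  assumes "m \<le> n"
  shows "(\<Sum>k=m..<n. f k) - (\<Sum>k=m..<n. f (k + r)) = (\<Sum>k=m..<m+r. f k) - (\<Sum>k=n..<n+r. f k)"
proof -
  have "(\<Sum>k=m..<n. f (k + r)) = (\<Sum>k=m+r..<n+r. f k)"
    by (rule sum.shift_bounds_nat_ivl [symmetric])
  moreover have "(\<Sum>k=m..<n. f k) + (\<Sum>k=n..<n+r. f k) = (\<Sum>k=m..<m+r. f k) + (\<Sum>k=m+r..<n+r. f k)"
    using assms by (simp add: sum.atLeastLessThan_concat)
  ultimately show ?thesis by (simp add: algebra_simps)
qed

text \<open>
  Multiplying the block by \<open>z ^ r\<close> shifts the exponents by \<open>r\<close>, so the product and the block differ
  by the sum of the \<open>r\<close>-step differences and by \<open>r\<close> boundary terms at either end.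
\<close>

lemma norm_power_sum_times_le:
  fixes a :: "nat \<Rightarrow> complex"
  assumes z: "norm z = 1" and M: "\<And>k. k \<ge> m \<Longrightarrow> norm (a k) \<le> M" and "m \<le> n"
  shows "norm (z ^ r - 1) * norm (\<Sum>k=m..<n. a k * z ^ k)
       \<le> (\<Sum>k=m..<n. norm (Delta r a k)) + 2 * real r * M"
proof -
  let ?f = "\<lambda>k. a k * z ^ k"
  have "(\<Sum>k=m..<n. Delta r a k * z ^ (k + r)) = z ^ r * (\<Sum>k=m..<n. ?f k) - (\<Sum>k=m..<n. ?f (k + r))"
    by (simp add: Delta_def sum_distrib_left sum_subtractf power_add algebra_simps)
  hence "(z ^ r - 1) * (\<Sum>k=m..<n. ?f k) = (\<Sum>k=m..<n. Delta r a k * z ^ (k + r))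
      - ((\<Sum>k=m..<m+r. ?f k) - (\<Sum>k=n..<n+r. ?f k))"
    by (simp only: sum_shift_diff[OF \<open>m \<le> n\<close>, of ?f r, symmetric]) (simp add: left_diff_distrib)
  hence "norm (z ^ r - 1) * norm (\<Sum>k=m..<n. ?f k) = norm ((\<Sum>k=m..<n. Delta r a k * z ^ (k + r))
      - ((\<Sum>k=m..<m+r. ?f k) - (\<Sum>k=n..<n+r. ?f k)))"
    by (metis norm_mult)
  also have "\<dots> \<le> norm (\<Sum>k=m..<n. Delta r a k * z ^ (k + r))
      + (norm (\<Sum>k=m..<m+r. ?f k) + norm (\<Sum>k=n..<n+r. ?f k))"
    by (meson add_left_mono norm_triangle_ineq4 order_trans)
  also have "norm (\<Sum>k=m..<n. Delta r a k * z ^ (k + r)) \<le> (\<Sum>k=m..<n. norm (Delta r a k))"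
    by (rule sum_norm_le) (simp add: norm_mult norm_power z)
  also have "norm (\<Sum>k=m..<m+r. ?f k) \<le> real (card {m..<m+r}) * M"
    by (rule sum_norm_bound) (simp add: norm_mult norm_power z M)
  also have "norm (\<Sum>k=n..<n+r. ?f k) \<le> real (card {n..<n+r}) * M"
    using \<open>m \<le> n\<close> by (intro sum_norm_bound) (simp add: norm_mult norm_power z M)
  finally show ?thesis by (simp add: mult_ac)
qed

text \<open>
  The Taylor bound \<open>\<bar>sin y - y\<bar> \<le> \<bar>y\<bar> ^ 3 / 6\<close> loses at most \<open>2/3 * \<bar>y\<bar>\<close> on this interval, which
  contains \<open>[-\<pi>/2, \<pi>/2]\<close>.
\<close>

lemma abs_sin_ge_third:
  assumes "\<bar>y::real\<bar> \<le> 2"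
  shows "\<bar>y\<bar> / 3 \<le> \<bar>sin y\<bar>"
proof -
  have "\<bar>sin y - (\<Sum>m<3. sin_coeff m * y ^ m)\<bar> \<le> inverse (fact 3) * \<bar>y\<bar> ^ 3"
    by (rule Maclaurin_sin_bound)
  also have "(\<Sum>m<3. sin_coeff m * y ^ m) = y" by (simp add: sin_coeff_def numeral_eq_Suc)
  also have "inverse (fact 3) * \<bar>y\<bar> ^ 3 = \<bar>y\<bar> * (\<bar>y\<bar> ^ 2 / 6)"
    by (simp add: fact_numeral power3_eq_cube power2_eq_square)
  also have "\<dots> \<le> \<bar>y\<bar> * (2 ^ 2 / 6)"
    using assms by (intro mult_left_mono divide_right_mono power_mono) auto
  finally have "\<bar>sin y - y\<bar> \<le> \<bar>y\<bar> * (2 / 3)" by simp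
  thus ?thesis by linarith
qed

lemma cmod_cis_power_minus_1_ge:
  fixes x t :: real and l :: int
  assumes "r \<ge> 1" and x: "x = 2 * pi * of_int l / real r + t" and t: "\<bar>t\<bar> \<le> pi / real r"
  shows "\<bar>t\<bar> / 3 \<le> cmod (cis x ^ r - 1)"
proof -
  have "real r * x = 2 * pi * of_int l + real r * t" using assms by (simp add: field_simps)
  hence "cis x ^ r = cis (2 * pi * of_int l) * cis (real r * t)"
    by (simp only: Complex.DeMoivre cis_mult)
  also have "cis (2 * pi * of_int l) = 1" by (rule cis_multiple_2pi) auto
  finally have "cmod (cis x ^ r - 1) = 2 * \<bar>sin (real r * t / 2)\<bar>"
    using dist_exp_i_1[of "real r * t"] by (simp add: cis_conv_exp)
  moreover have "\<bar>real r * t / 2\<bar> / 3 \<le> \<bar>sin (real r * t / 2)\<bar>"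
  proof (rule abs_sin_ge_third)
    have "\<bar>real r * t\<bar> \<le> pi" using t assms by (simp add: abs_mult field_simps)
    thus "\<bar>real r * t / 2\<bar> \<le> 2" using pi_less_4 by simp
  qed
  moreover have "\<bar>t\<bar> \<le> \<bar>real r * t\<bar>"
    using assms mult_right_mono[of 1 "real r" "\<bar>t\<bar>"] by (simp add: abs_mult)
  ultimately show ?thesis by simp
qed

text \<open>
  The sine is half the difference of the exponentials at \<open>x\<close> and \<open>- x\<close>; both points have distance
  \<open>\<bar>t\<bar>\<close> from a node, so the same estimate serves for both.
\<close>

lemma norm_sine_sum_le:
  fixes a :: "nat \<Rightarrow> complex" and x t :: real and l :: int
  assumes "r \<ge> 1" and x: "x = 2 * pi * of_int l / real r + t" and t: "\<bar>t\<bar> \<le> pi / real r"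
    and M: "\<And>k. k \<ge> m \<Longrightarrow> norm (a k) \<le> M" and "m \<le> n"
  shows "\<bar>t\<bar> / 3 * norm (\<Sum>k=m..<n. a k * of_real (sin (real k * x)))
       \<le> (\<Sum>k=m..<n. norm (Delta r a k)) + 2 * real r * M" (is "_ \<le> ?B")
proof -
  define S where "S y = (\<Sum>k=m..<n. a k * cis y ^ k)" for y
  have S: "\<bar>t\<bar> / 3 * norm (S y) \<le> ?B"
    if "y = 2 * pi * of_int j / real r + u" "\<bar>u\<bar> = \<bar>t\<bar>" for y u j
  proof -
    have "\<bar>t\<bar> / 3 \<le> cmod (cis y ^ r - 1)"
      using cmod_cis_power_minus_1_ge[OF \<open>r \<ge> 1\<close> that(1)] that t by simp
    hence "\<bar>t\<bar> / 3 * norm (S y) \<le> cmod (cis y ^ r - 1) * norm (S y)"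
      by (intro mult_right_mono) auto
    also have "\<dots> \<le> ?B" unfolding S_def
      by (intro norm_power_sum_times_le) (use assms in auto)
    finally show ?thesis .
  qed
  have "of_real (sin (real k * x)) = (cis x ^ k - cis (- x) ^ k) / (2 * \<i>)" for k
    by (simp add: complex_eq_iff Complex.DeMoivre)
  hence "(\<Sum>k=m..<n. a k * of_real (sin (real k * x))) = (S x - S (- x)) / (2 * \<i>)"
    by (simp only: S_def right_diff_distrib times_divide_eq_right sum_subtractf flip: sum_divide_distrib)
  hence "norm (\<Sum>k=m..<n. a k * of_real (sin (real k * x))) = norm (S x - S (- x)) / 2"
    by (simp add: norm_divide norm_mult)
  also have "\<dots> \<le> (norm (S x) + norm (S (- x))) / 2"
    by (intro divide_right_mono norm_triangle_ineq4) auto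
  finally have "\<bar>t\<bar> / 3 * norm (\<Sum>k=m..<n. a k * of_real (sin (real k * x)))
      \<le> \<bar>t\<bar> / 3 * ((norm (S x) + norm (S (- x))) / 2)"
    by (intro mult_left_mono) auto
  also have "\<dots> = (\<bar>t\<bar> / 3 * norm (S x) + \<bar>t\<bar> / 3 * norm (S (- x))) / 2"
    by (simp add: algebra_simps)
  also have "\<dots> \<le> (?B + ?B) / 2"
    using x by (intro divide_right_mono add_mono S[of x l t] S[of "- x" "- l" "- t"]) auto
  also have "\<dots> = ?B" by (simp only: add_divide_distrib field_sum_of_halves)
  finally show ?thesis .
qed


section \<open>The series at the nodes\<close>

lemma sin_node_mod:
  assumes "r \<ge> 1"
  shows "sin (real k * (2 * pi * of_int l / real r))
       = sin (real k * (2 * pi * of_int (l mod int r) / real r))"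
proof -
  define d j where "d = l div int r" and "j = l mod int r"
  have "l = d * int r + j" by (simp add: d_def j_def)
  hence "real k * (2 * pi * of_int l / real r)
      = real k * (2 * pi * of_int j / real r) + 2 * pi * of_int (int k * d)"
    using assms by (simp add: field_simps)
  thus ?thesis by (simp add: sin_add sin_int_2pin cos_int_2pin j_def del: of_int_mult)
qed

text \<open>
  Periodicity and the reflection \<open>j \<mapsto> r - j\<close>, which only changes the sign, reduce every node to one
  with \<open>0 \<le> 2 j \<le> r\<close>; at the two ends \<open>j = 0\<close> and \<open>2 j = r\<close> all sines vanish.
\<close>

lemma summable_sine_series_at_nodes:
  fixes a :: "nat \<Rightarrow> complex" and l :: int
  assumes "r \<ge> 1" and summable: "\<And>j::nat. 0 < j \<Longrightarrow> 2 * j < r \<Longrightarrow>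
     summable (\<lambda>k. a k * of_real (sin (real k * (2 * pi * real j / real r))))"
  shows "summable (\<lambda>k. a k * of_real (sin (real k * (2 * pi * of_int l / real r))))"
proof -
  define j where "j = nat (l mod int r)"
  have j: "l mod int r = int j" "j < r" using assms by (auto simp: j_def nat_less_iff)
  have "summable (\<lambda>k. a k * of_real (sin (real k * (2 * pi * real j / real r))))"
  proof (cases "2 * j" r rule: linorder_cases)
    case less
    thus ?thesis using summable[of j] by (cases "j = 0") auto
  next
    case equal
    hence "real r = 2 * real j" by simp
    hence "sin (real k * (2 * pi * real j / real r)) = 0" for k
      using assms by simp
    thus ?thesis by simp
  next
    case greater
    have "sin (real k * (2 * pi * real j / real r))
        = - sin (real k * (2 * pi * real (r - j) / real r))" for k
    proof -
      have "real k * (2 * pi * real j / real r)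
          = 2 * pi * of_int (int k) - real k * (2 * pi * real (r - j) / real r)"
        using j assms by (simp add: of_nat_diff field_simps)
      thus ?thesis by (simp only: sin_diff sin_int_2pin cos_int_2pin)
    qed
    moreover have "summable (\<lambda>k. a k * of_real (sin (real k * (2 * pi * real (r - j) / real r))))"
      using greater j by (intro summable) auto
    ultimately show ?thesis by (simp add: summable_minus_iff)
  qed
  thus ?thesis using sin_node_mod[OF \<open>r \<ge> 1\<close>, of _ l] j by simp
qed

text \<open>One \<open>N\<close> serves for all nodes because the terms depend only on \<open>l\<close> modulo \<open>r\<close>.\<close>

lemma sine_series_at_nodes_uniformly_small:
  fixes a :: "nat \<Rightarrow> complex"
  assumes "r \<ge> 1" "\<eta> > 0" and summable: "\<And>l::int.
     summable (\<lambda>k. a k * of_real (sin (real k * (2 * pi * of_int l / real r))))"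
  obtains N where "\<And>(l::int) m n. m \<ge> N \<Longrightarrow>
     norm (\<Sum>k=m..<n. a k * of_real (sin (real k * (2 * pi * of_int l / real r)))) \<le> \<eta>"
proof -
  let ?S = "\<lambda>(l::int) m n. norm (\<Sum>k=m..<n. a k * of_real (sin (real k * (2 * pi * of_int l / real r))))"
  have "\<forall>l. \<exists>N. \<forall>m\<ge>N. \<forall>n. ?S l m n < \<eta>"
    using summable \<open>\<eta> > 0\<close> unfolding summable_Cauchy by blast
  then obtain N where N: "\<And>l m n. m \<ge> N l \<Longrightarrow> ?S l m n < \<eta>" by metis
  define N0 where "N0 = Max (N ` {0..<int r})"
  show ?thesis
  proof (rule that[of N0])
    fix l :: int and m n assume m: "m \<ge> N0"
    have "l mod int r \<in> {0..<int r}" using assms by auto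
    hence "N (l mod int r) \<le> N0" unfolding N0_def by (intro Max_ge) auto
    hence "?S (l mod int r) m n < \<eta>" using m by (intro N) auto
    also have "?S (l mod int r) m n = ?S l m n"
      by (simp only: sin_node_mod[OF \<open>r \<ge> 1\<close>, of _ l])
    finally show "?S l m n \<le> \<eta>" by simp
  qed
qed

lemma nearest_node:
  fixes x :: real
  assumes "r \<ge> 1"
  obtains l :: int and t where "x = 2 * pi * of_int l / real r + t" "\<bar>t\<bar> \<le> pi / real r"
proof -
  define y where "y = x * real r / (2 * pi)"
  have "\<bar>y - of_int (round y)\<bar> \<le> 1 / 2"
    using of_int_round_abs_le[of y] by (simp add: abs_minus_commute)
  hence "\<bar>(y - of_int (round y)) * (2 * pi / real r)\<bar> \<le> 1 / 2 * (2 * pi / real r)"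
    unfolding abs_mult by (intro mult_mono) auto
  moreover have "x = 2 * pi * of_int (round y) / real r + (y - of_int (round y)) * (2 * pi / real r)"
    using assms by (simp add: y_def field_simps)
  ultimately show ?thesis using that by simp
qed

section \<open>The three ranges of a block\<close>

lemma norm_sine_block_near_node_le:
  fixes a :: "nat \<Rightarrow> complex"
  assumes ak: "\<And>k. k \<ge> m \<Longrightarrow> real k * norm (a k) \<le> \<eta>"
    and node: "norm (\<Sum>k=m..<n. a k * of_real (sin (real k * y))) \<le> \<eta>"
    and "1 \<le> m" "m < n" and short: "real (n - 1) * \<bar>t\<bar> \<le> 1"
  shows "norm (\<Sum>k=m..<n. a k * of_real (sin (real k * (y + t)))) \<le> 2 * \<eta>"
proof -
  have \<eta>: "\<eta> \<ge> 0" using node norm_ge_zero order_trans by blast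
  have sin_diff: "\<bar>sin (u + v) - sin u\<bar> \<le> \<bar>v\<bar>" for u v :: real
  proof -
    have "sin (u + v) - sin u = 2 * sin (v / 2) * cos ((u + v + u) / 2)"
      using sin_diff_sin[of "u + v" u] by simp
    hence "\<bar>sin (u + v) - sin u\<bar> = 2 * \<bar>sin (v / 2)\<bar> * \<bar>cos ((u + v + u) / 2)\<bar>"
      by (simp add: abs_mult)
    also have "\<dots> \<le> 2 * \<bar>v / 2\<bar> * 1"
      by (intro mult_mono abs_sin_x_le_abs_x) auto
    finally show ?thesis by simp
  qed
  have "norm ((\<Sum>k=m..<n. a k * of_real (sin (real k * (y + t))))
            - (\<Sum>k=m..<n. a k * of_real (sin (real k * y))))
      = norm (\<Sum>k=m..<n. a k * of_real (sin (real k * (y + t)) - sin (real k * y)))"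
    by (simp add: sum_subtractf right_diff_distrib)
  also have "\<dots> \<le> (\<Sum>k=m..<n. \<eta> * \<bar>t\<bar>)"
  proof (rule sum_norm_le)
    fix k assume k: "k \<in> {m..<n}"
    have "norm (a k * of_real (sin (real k * (y + t)) - sin (real k * y)))
        = norm (a k) * \<bar>sin (real k * (y + t)) - sin (real k * y)\<bar>"
      by (simp only: norm_mult norm_of_real)
    also have "\<dots> \<le> norm (a k) * \<bar>real k * t\<bar>"
      using sin_diff[of "real k * y" "real k * t"] by (intro mult_left_mono) (auto simp: algebra_simps)
    also have "\<dots> = real k * norm (a k) * \<bar>t\<bar>" by (simp add: abs_mult)
    also have "\<dots> \<le> \<eta> * \<bar>t\<bar>" using k by (intro mult_right_mono ak) auto
    finally show "norm (a k * of_real (sin (real k * (y + t)) - sin (real k * y))) \<le> \<eta> * \<bar>t\<bar>" .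
  qed
  also have "\<dots> = \<eta> * (real (n - m) * \<bar>t\<bar>)" by simp
  also have "\<dots> \<le> \<eta> * (real (n - 1) * \<bar>t\<bar>)"
    using \<eta> \<open>1 \<le> m\<close> by (intro mult_left_mono mult_right_mono) auto
  also have "\<dots> \<le> \<eta> * 1" using \<eta> short by (intro mult_left_mono)
  finally show ?thesis
    using node norm_triangle_sub[of "\<Sum>k=m..<n. a k * of_real (sin (real k * (y + t)))"
      "\<Sum>k=m..<n. a k * of_real (sin (real k * y))"] by simp
qed

lemma norm_sine_block_log_range_le:
  fixes a :: "nat \<Rightarrow> complex"
  assumes ak: "\<And>k. k \<ge> m \<Longrightarrow> real k * ln (real k) * norm (a k) \<le> \<eta>" and "\<eta> \<ge> 0"
    and "3 \<le> m" "m < n" and short: "real (n - 1) \<le> real m powr p"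
  shows "norm (\<Sum>k=m..<n. a k * of_real (sin (real k * x))) \<le> \<eta> * ln (2 * p)"
proof -
  have "norm (\<Sum>k=m..<n. a k * of_real (sin (real k * x))) \<le> (\<Sum>k=m..<n. \<eta> * (1 / (real k * ln (real k))))"
  proof (rule sum_norm_le)
    fix k assume k: "k \<in> {m..<n}"
    have "norm (a k * of_real (sin (real k * x))) \<le> norm (a k) * 1"
      unfolding norm_mult by (intro mult_left_mono) auto
    also have "\<dots> \<le> \<eta> * (1 / (real k * ln (real k)))"
      using k ak[of k] \<open>3 \<le> m\<close> by (simp add: field_simps)
    finally show "norm (a k * of_real (sin (real k * x))) \<le> \<eta> * (1 / (real k * ln (real k)))" .
  qed
  also have "\<dots> = \<eta> * (\<Sum>k=m..<n. 1 / (real k * ln (real k)))"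
    by (rule sum_distrib_left [symmetric])
  also have "\<dots> \<le> \<eta> * ln (2 * p)"
    using assms by (intro mult_left_mono sum_inverse_mult_ln_le) auto
  finally show ?thesis .
qed

text \<open>
  Summation by parts costs \<open>3 / \<bar>t\<bar>\<close>, which is at most \<open>3 * m powr (1/p)\<close> in this range. That is
  what the bound for the differences allows for; the boundary terms, of size \<open>\<eta> / m\<close>, are smaller
  still.
\<close>

lemma norm_sine_block_far_le:
  fixes a :: "nat \<Rightarrow> complex" and l :: int
  assumes "r \<ge> 1" "p \<ge> 1" "1 \<le> m" "m \<le> n" "\<eta> \<ge> 0"
    and x: "x = 2 * pi * of_int l / real r + t" and t: "\<bar>t\<bar> \<le> pi / real r"
    and ak: "\<And>k. k \<ge> m \<Longrightarrow> real k * norm (a k) \<le> \<eta>"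
    and Delta: "(\<Sum>k=m..<n. norm (Delta r a k)) \<le> \<eta> * real m powr - (1 / p)"
    and far: "1 \<le> \<bar>t\<bar> * real m powr (1 / p)"
  shows "norm (\<Sum>k=m..<n. a k * of_real (sin (real k * x))) \<le> 3 * (1 + 2 * real r) * \<eta>"
    (is "norm ?S \<le> _")
proof -
  have m: "real m \<ge> 1" using assms by simp
  have ak': "norm (a k) \<le> \<eta> * real m powr - (1 / p)" if "k \<ge> m" for k
  proof -
    have "real m * norm (a k) \<le> real k * norm (a k)" using that by (intro mult_right_mono) auto
    also have "\<dots> \<le> \<eta>" using that by (rule ak)
    finally have "norm (a k) \<le> \<eta> * real m powr - 1" using m by (simp add: powr_minus field_simps)
    also have "\<dots> \<le> \<eta> * real m powr - (1 / p)"
      using m assms by (intro mult_left_mono powr_mono) auto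
    finally show ?thesis .
  qed
  have "1 / 3 * norm ?S \<le> \<bar>t\<bar> * real m powr (1 / p) / 3 * norm ?S"
    using far by (intro mult_right_mono) auto
  also have "\<dots> = (\<bar>t\<bar> / 3 * norm ?S) * real m powr (1 / p)" by simp
  also have "\<dots> \<le> ((\<Sum>k=m..<n. norm (Delta r a k)) + 2 * real r * (\<eta> * real m powr - (1 / p)))
      * real m powr (1 / p)"
    using assms ak' by (intro mult_right_mono norm_sine_sum_le[of r x l]) auto
  also have "\<dots> \<le> (\<eta> * real m powr - (1 / p) + 2 * real r * (\<eta> * real m powr - (1 / p)))
      * real m powr (1 / p)"
    by (intro mult_right_mono add_right_mono Delta) auto
  also have "\<dots> = (1 + 2 * real r) * \<eta> * (real m powr - (1 / p) * real m powr (1 / p))"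
    by (simp add: algebra_simps)
  also have "real m powr - (1 / p) * real m powr (1 / p) = 1"
    using m by (simp flip: powr_add)
  finally show ?thesis by (simp add: algebra_simps)
qed

text \<open>
  The cuts are placed at \<open>u = 1 / \<bar>t\<bar>\<close> and \<open>u powr p\<close>. Clamping them to \<open>m \<le> m1 \<le> m2 \<le> n\<close> leaves
  a part empty when its range misses the block.
\<close>

lemma norm_sine_block_le:
  fixes a :: "nat \<Rightarrow> complex" and x :: real
  assumes "r \<ge> 1" "p > 1" "3 \<le> m" "m \<le> n" "\<eta> \<ge> 0"
    and ak: "\<And>k. k \<ge> m \<Longrightarrow> real k * ln (real k) * norm (a k) \<le> \<eta>"
    and node: "\<And>(l::int) n. 
      norm (\<Sum>k=m..<n. a k * of_real (sin (real k * (2 * pi * of_int l / real r)))) \<le> \<eta>"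
    and Delta: "\<And>m' n. m' \<ge> m \<Longrightarrow> (\<Sum>k=m'..<n. norm (Delta r a k)) \<le> \<eta> * real m' powr - (1 / p)"
  shows "norm (\<Sum>k=m..<n. a k * of_real (sin (real k * x)))
       \<le> (2 + ln (2 * p) + 3 * (1 + 2 * real r)) * \<eta>"
proof -
  obtain l :: int and t where x: "x = 2 * pi * of_int l / real r + t" and t: "\<bar>t\<bar> \<le> pi / real r"
    using nearest_node[OF \<open>r \<ge> 1\<close>] by blast
  have lnp: "ln (2 * p) \<ge> 0" using \<open>p > 1\<close> by simp
  have ak': "real k * norm (a k) \<le> \<eta>" if "k \<ge> m" for k
    by (rule order_trans [OF mult_le_mult_ln_mult ak]) (use that \<open>3 \<le> m\<close> in auto)
  let ?S = "\<lambda>m n. \<Sum>k=m..<n. a k * of_real (sin (real k * x))"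
  show ?thesis
  proof (cases "t = 0")
    case True
    have "norm (?S m n) \<le> \<eta>" using node[of l n] x True by simp
    also have "\<dots> \<le> (2 + ln (2 * p) + 3 * (1 + 2 * real r)) * \<eta>"
      using mult_right_mono[of 1 "2 + ln (2 * p) + 3 * (1 + 2 * real r)" \<eta>] lnp \<open>\<eta> \<ge> 0\<close> by simp
    finally show ?thesis .
  next
    case False
    define u where "u = 1 / \<bar>t\<bar>"
    have u: "u > 0" "\<bar>t\<bar> * u = 1" using False by (auto simp: u_def)
    \<comment> \<open>The first indices beyond the two cuts.\<close>
    define L1 L2 where "L1 = Suc (nat \<lfloor>u\<rfloor>)" and "L2 = Suc (nat \<lfloor>u powr p\<rfloor>)"
    have L1: "real (L1 - 1) \<le> u" "u \<le> real L1" and L2: "real (L2 - 1) \<le> u powr p" "u powr p \<le> real L2"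
      using u unfolding L1_def L2_def by (simp_all add: of_nat_nat) linarith+
    define m1 m2 where "m1 = max m (min n L1)" and "m2 = max m1 (min n L2)"
    have ord: "m \<le> m1" "m1 \<le> m2" "m2 \<le> n" using \<open>m \<le> n\<close> by (auto simp: m1_def m2_def)
    have A: "norm (?S m m1) \<le> 2 * \<eta>"
    proof (cases "m < m1")
      case True
      hence "m1 - 1 \<le> L1 - 1" by (auto simp: m1_def)
      hence "real (m1 - 1) \<le> u" using L1 by linarith
      hence "real (m1 - 1) * \<bar>t\<bar> \<le> 1" using u mult_right_mono[of "real (m1 - 1)" u "\<bar>t\<bar>"]
        by (simp add: mult.commute)
      thus ?thesis unfolding x using True ak' node \<open>3 \<le> m\<close>
        by (intro norm_sine_block_near_node_le) auto
    qed (use \<open>\<eta> \<ge> 0\<close> in simp)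
    have B: "norm (?S m1 m2) \<le> \<eta> * ln (2 * p)"
    proof (cases "m1 < m2")
      case True
      hence "m2 = min n L2" by (simp add: m2_def max_def split: if_splits)
      hence "m2 - 1 \<le> L2 - 1" by simp
      moreover have "L1 \<le> m1" using True ord by (auto simp: m1_def)
      ultimately have "real (m2 - 1) \<le> u powr p" "u \<le> real m1" using L1 L2 by linarith+
      moreover from this have "u powr p \<le> real m1 powr p"
        using u \<open>p > 1\<close> by (intro powr_mono2) auto
      ultimately have "real (m2 - 1) \<le> real m1 powr p" by linarith
      thus ?thesis using True ak ord \<open>3 \<le> m\<close> \<open>\<eta> \<ge> 0\<close>
        by (intro norm_sine_block_log_range_le) auto
    qed (use \<open>\<eta> \<ge> 0\<close> lnp in simp)
    have C: "norm (?S m2 n) \<le> 3 * (1 + 2 * real r) * \<eta>"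
    proof (cases "m2 < n")
      case True
      hence "L2 \<le> m2" by (auto simp: m2_def)
      hence "u powr p \<le> real m2" using L2 by linarith
      hence "(u powr p) powr (1 / p) \<le> real m2 powr (1 / p)"
        using \<open>p > 1\<close> by (intro powr_mono2) auto
      hence "u \<le> real m2 powr (1 / p)" using u \<open>p > 1\<close> by (simp add: powr_powr)
      hence "\<bar>t\<bar> * u \<le> \<bar>t\<bar> * real m2 powr (1 / p)" by (intro mult_left_mono) auto
      thus ?thesis using ak' Delta ord x t u True \<open>r \<ge> 1\<close> \<open>p > 1\<close> \<open>3 \<le> m\<close> \<open>\<eta> \<ge> 0\<close>
        by (intro norm_sine_block_far_le[of r p m2 n \<eta> x l t]) auto
    qed (use \<open>\<eta> \<ge> 0\<close> in simp)
    have "?S m n = ?S m m1 + ?S m1 m2 + ?S m2 n"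
      using ord by (simp add: sum.atLeastLessThan_concat)
    hence "norm (?S m n) \<le> norm (?S m m1) + norm (?S m1 m2) + norm (?S m2 n)"
      by (metis (no_types, lifting) norm_triangle_mono norm_triangle_ineq order_refl)
    also have "\<dots> \<le> 2 * \<eta> + \<eta> * ln (2 * p) + 3 * (1 + 2 * real r) * \<eta>"
      by (intro add_mono A B C)
    finally show ?thesis by (simp add: algebra_simps)
  qed
qed

section \<open>Uniform convergence\<close>

theorem theorem10:
  fixes p q c :: real and r :: nat and b :: "nat \<Rightarrow> complex"
  assumes "p > 1" and "q \<ge> 1" and "r \<ge> 1" and "c > 0"
    and "b \<in> GM p q r"
    and "(\<lambda>n. real n * ln (real n) * cmod (b n)) \<longlonglongrightarrow> 0"
    and "\<And>l. r \<ge> 3 \<Longrightarrow> even r \<Longrightarrow> l \<in> {1..r div 2 - 1} \<Longrightarrow>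
           summable (\<lambda>k. b (Suc k) * complex_of_real (sin (2 * real l * pi / real r * real (Suc k))))"
    and "\<And>l. r \<ge> 3 \<Longrightarrow> odd r \<Longrightarrow> l \<in> {1..r div 2} \<Longrightarrow>
           summable (\<lambda>k. b (Suc k) * complex_of_real (sin (2 * real l * pi / real r * real (Suc k))))"
  shows "uniformly_convergent_on (UNIV :: real set)
           (\<lambda>N x. \<Sum>n=1..N. b n * complex_of_real (sin (c * real n * x)))"
proof (intro Cauchy_uniformly_convergent uniformly_Cauchy_onI')
  fix \<epsilon> :: real assume "\<epsilon> > 0"
  define K where "K = 2 + ln (2 * p) + 3 * (1 + 2 * real r)"
  have K: "K > 0" using \<open>p > 1\<close> by (simp add: K_def add_pos_nonneg)
  define \<eta> where "\<eta> = \<epsilon> / (2 * K)"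
  have \<eta>: "\<eta> > 0" using K \<open>\<epsilon> > 0\<close> by (simp add: \<eta>_def)
  have interior: "summable (\<lambda>k. b k * of_real (sin (real k * (2 * pi * real j / real r))))"
    if "0 < j" "2 * j < r" for j :: nat
  proof -
    have "summable (\<lambda>k. b (Suc k) * complex_of_real (sin (2 * real j * pi / real r * real (Suc k))))"
      using assms(7,8)[of j] that by (cases "even r") auto
    thus ?thesis by (subst summable_Suc_iff [symmetric]) (simp add: mult_ac)
  qed
  obtain N1 where N1: "\<And>(l::int) m n. m \<ge> N1 \<Longrightarrow>
     norm (\<Sum>k=m..<n. b k * of_real (sin (real k * (2 * pi * of_int l / real r)))) \<le> \<eta>"
    using sine_series_at_nodes_uniformly_small[OF \<open>r \<ge> 1\<close> \<eta>
      summable_sine_series_at_nodes[OF \<open>r \<ge> 1\<close> interior]] by blast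
  have "eventually (\<lambda>n. real n * ln (real n) * cmod (b n) < \<eta>) sequentially"
    using order_tendstoD(2)[OF assms(6) \<eta>] .
  then obtain N2 where N2: "\<And>n. n \<ge> N2 \<Longrightarrow> real n * ln (real n) * cmod (b n) < \<eta>"
    by (auto simp: eventually_sequentially)
  have n_bn: "(\<lambda>n. real n * cmod (b n)) \<longlonglongrightarrow> 0"
  proof (rule Lim_null_comparison[OF _ assms(6)])
    show "\<forall>\<^sub>F n in sequentially. norm (real n * cmod (b n)) \<le> real n * ln (real n) * cmod (b n)"
      using eventually_ge_at_top[of 3] by eventually_elim (simp add: mult_le_mult_ln_mult)
  qed
  obtain N3 where N3: "\<And>m n. m \<ge> N3 \<Longrightarrow>
    (\<Sum>k=m..<n. cmod (Delta r b k)) \<le> \<eta> * real m powr - (1 / p)"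
    using GM_imp_sum_Delta_le[OF \<open>b \<in> GM p q r\<close> \<open>p > 1\<close> \<open>q \<ge> 1\<close> n_bn \<eta>] by blast
  define M where "M = max 3 (max N1 (max N2 N3))"
  show "\<exists>M. \<forall>x\<in>UNIV. \<forall>m\<ge>M. \<forall>n>m.
      dist (\<Sum>n=1..m. b n * complex_of_real (sin (c * real n * x)))
           (\<Sum>n=1..n. b n * complex_of_real (sin (c * real n * x))) < \<epsilon>"
  proof (intro exI[of _ M] ballI allI impI)
    fix x :: real and m n :: nat assume m: "m \<ge> M" and "n > m"
    let ?f = "\<lambda>k. b k * complex_of_real (sin (c * real k * x))"
    have "sum ?f {1..n} = sum ?f {1..m} + sum ?f {Suc m..<Suc n}"
      using \<open>n > m\<close> sum.atLeastLessThan_concat[of 1 "Suc m" "Suc n" ?f]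
      by (simp add: atLeastLessThanSuc_atLeastAtMost)
    hence "dist (sum ?f {1..m}) (sum ?f {1..n}) = norm (sum ?f {Suc m..<Suc n})"
      by (simp add: dist_norm norm_minus_commute)
    also have "sum ?f {Suc m..<Suc n} = (\<Sum>k=Suc m..<Suc n. b k * of_real (sin (real k * (c * x))))"
      by (simp add: mult_ac)
    also have "norm \<dots> \<le> K * \<eta>" unfolding K_def
    proof (rule norm_sine_block_le[OF \<open>r \<ge> 1\<close> \<open>p > 1\<close>])
      show "real k * ln (real k) * cmod (b k) \<le> \<eta>" if "k \<ge> Suc m" for k
        using N2[of k] that m by (simp add: M_def)
      show "norm (\<Sum>k=Suc m..<n'. b k * of_real (sin (real k * (2 * pi * of_int l / real r)))) \<le> \<eta>"
        for l :: int and n' using m by (intro N1) (simp add: M_def)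
      show "(\<Sum>k=m'..<n'. cmod (Delta r b k)) \<le> \<eta> * real m' powr - (1 / p)"
        if "m' \<ge> Suc m" for m' n' using m that by (intro N3) (simp add: M_def)
    qed (use \<eta> m \<open>n > m\<close> in \<open>auto simp: M_def\<close>)
    also have "\<dots> = \<epsilon> / 2" using K by (simp add: \<eta>_def)
    also have "\<dots> < \<epsilon>" using \<open>\<epsilon> > 0\<close> by simp
    finally show "dist (sum ?f {1..m}) (sum ?f {1..n}) < \<epsilon>" .
  qed
qed

end
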